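(* In the setting described in the context, let $a\in Q$. Then for any $\varphi=(\varphi_1,\ldots,\varphi_n)\in\mathbb{N}^r\times\mathbb{Z}^s$ such that $L\varphi=a$, one has $$S_a=x^{\varphi}\,k[\omega(\mathcal{P}_\varphi\cap\mathbb{Z}^l)],$$ where $\mathcal{P}_\varphi=\{u\in M_{\mathbb{R}}\mid\langle u,v_i\rangle\ge-\varphi_i\text{ for all }i=1,\ldots,r\}$ and, for a subset $E\subseteq\mathbb{Z}^n$, $k[E]$ denotes the $k$-span of the monomials $x^\lambda$ with $\lambda\in E$.
   Context: $k$ is an algebraically closed field of characteristic $0$, $n=r+s$, $X=k^r\times(k^{\times})^s$, $S=k[x_1,\ldots,x_r,x_{r+1}^{\pm1},\ldots,x_n^{\pm1}]$. $H=(k^\times)^p\times\mathbb{F}$ with $\mathbb{F}$ a product of cyclic groups of orders $d_1,\ldots,d_t$; $m=p+t$; the character group $A=\mathrm{Hom}(H,k^\times)$ is identified with $\mathbb{Z}^p\oplus\mathbb{Z}/d_1\mathbb{Z}\oplus\cdots\oplus\mathbb{Z}/d_t\mathbb{Z}$. $H$ acts diagonally and faithfully on $X$ with weights $\eta_1,\ldots,\eta_n\in A$ ($h$ multiplies the $i$-th coordinate by $\eta_i(h)$), and $L$ is the $m\times n$ integer matrix whose $i$-th column represents $\eta_i$. The degree map is $\deg:\mathbb{Z}^n\to A$, $\deg(\lambda)=L\lambda$ (read in $A$), i.e. $\deg(\lambda)=\sum\lambda_i\eta_i$. For $a\in A$, $S_a=\mathrm{span}_k\{x^\lambda\in S\mid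 L\lambda=a\}$, and $Q=\deg(\mathbb{N}^r\times\mathbb{Z}^s)\subseteq A$, with $0\in\mathbb{N}$. Put $l=n-p$. The kernel $\mathfrak{K}$ of $\deg$ is free of rank $l$; fix an $n\times l$ integer matrix $K$ whose columns form a $\mathbb{Z}$-basis of $\mathfrak{K}$, and let $v_1,\ldots,v_r\in N=\mathbb{Z}^l$ be its first $r$ rows. $M=\mathrm{Hom}(N,\mathbb{Z})\cong\mathbb{Z}^l$, with natural pairing $\langle\cdot,\cdot\rangle$, and $M_{\mathbb{R}}=M\otimes\mathbb{R}$. $\omega:M\to\mathfrak{K}\subset\mathbb{Z}^n$ is the isomorphism $\omega(u)=Ku$. Monomials $x^\lambda$, $\lambda\in\mathbb{Z}^n$, are taken in $k[x_1^{\pm1},\ldots,x_n^{\pm1}]$. *)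

theory Defs
  imports
    "HOL-Library.Poly_Mapping"
    "HOL-Algebra.Product_Groups"
    "HOL-Algebra.Elementary_Groups"
    "HOL-Algebra.Group_Action"
    "HOL-Algebra.Multiplicative_Group"
    "Jordan_Normal_Form.VS_Connect"
begin

text \<open>
  The variables, the standard coordinates of \<open>\<int>\<^sup>n\<close> and the rows of matrices are indexed from \<open>0\<close>:
  indices \<open>i < r\<close> belong to \<open>k\<^sup>r\<close>, and \<open>r \<le> i < r + s\<close> to the torus factor. In the same way the
  indices \<open>j < p\<close> of \<open>H\<close> and of \<open>A\<close> belong to the free part, and \<open>p + i\<close> with \<open>i < length ds\<close>
  to the cyclic factor of order \<open>ds ! i\<close>. So \<open>n = r + s\<close>, \<open>t = length ds\<close> and \<open>m = p + t\<close>.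
\<close>

subsection \<open>The group \<open>H\<close>, its characters, and its action on \<open>X\<close>\<close>

text \<open>The modulus \<open>0\<close> encodes the free factors: \<open>integer_mod_group 0\<close> is the group \<open>\<int>\<close>, and
  \<open>x mod 0 = x\<close>.\<close>

definition modulus :: "nat \<Rightarrow> nat list \<Rightarrow> nat \<Rightarrow> nat" where
  "modulus p ds j = (if j < p then 0 else ds ! (j - p))"

definition char_group :: "nat \<Rightarrow> nat list \<Rightarrow> (nat \<Rightarrow> int) monoid" where
  "char_group p ds =
     product_group {..<p + length ds} (\<lambda>j. integer_mod_group (modulus p ds j))"

text \<open>The class in \<open>A\<close> of an integer vector of length \<open>m\<close>.\<close>

definition char_class :: "nat \<Rightarrow> nat list \<Rightarrow> int vec \<Rightarrow> (nat \<Rightarrow> int)" where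
  "char_class p ds v = (\<lambda>j\<in>{..<p + length ds}. (v $ j) mod int (modulus p ds j))"

text \<open>The cyclic factor of order \<open>d\<close> is realised as the group of \<open>d\<close>-th roots of unity of \<open>k\<close>
  (cyclic of order \<open>d\<close>, as \<open>k\<close> is algebraically closed of characteristic \<open>0\<close>). This makes the
  identification of \<open>Hom(\<int>/d, k\<^sup>\<times>)\<close> with \<open>\<int>/d\<close> canonical. For \<open>d = 0\<close> the set below is all of
  \<open>k\<^sup>\<times>\<close>.\<close>

definition roots_group :: "nat \<Rightarrow> 'k::field monoid" where
  "roots_group d = (mult_of class_ring) \<lparr>carrier := {z. z \<noteq> 0 \<and> z ^ d = 1}\<rparr>"

definition diag_group :: "nat \<Rightarrow> nat list \<Rightarrow> (nat \<Rightarrow> 'k::field) monoid" where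
  "diag_group p ds = product_group {..<p + length ds} (\<lambda>j. roots_group (modulus p ds j))"

text \<open>The character of \<open>H\<close> that corresponds to an element of \<open>A\<close>.\<close>

definition character :: "nat \<Rightarrow> nat list \<Rightarrow> (nat \<Rightarrow> int) \<Rightarrow> (nat \<Rightarrow> 'k::field) \<Rightarrow> 'k" where
  "character p ds \<alpha> h = (\<Prod>j<p + length ds. h j powi \<alpha> j)"

definition weight :: "nat \<Rightarrow> nat list \<Rightarrow> int mat \<Rightarrow> nat \<Rightarrow> (nat \<Rightarrow> int)" where
  "weight p ds L i = char_class p ds (col L i)"

definition affine_torus :: "nat \<Rightarrow> nat \<Rightarrow> 'k::field vec set" where
  "affine_torus r s = {x \<in> carrier_vec (r + s). \<forall>i. r \<le> i \<and> i < r + s \<longrightarrow> x $ i \<noteq> 0}"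

text \<open>The restriction to \<open>X\<close> makes the map an element of \<open>BijGroup X\<close>, as \<open>group_action\<close> demands.\<close>

definition diag_action ::
    "nat \<Rightarrow> nat list \<Rightarrow> int mat \<Rightarrow> nat \<Rightarrow> nat \<Rightarrow> (nat \<Rightarrow> 'k::field) \<Rightarrow> 'k vec \<Rightarrow> 'k vec" where
  "diag_action p ds L r s h =
     (\<lambda>x\<in>affine_torus r s. Matrix.vec (r + s) (\<lambda>i. character p ds (weight p ds L i) h * x $ i))"

subsection \<open>The degree map and its kernel\<close>

definition deg_map :: "nat \<Rightarrow> nat list \<Rightarrow> int mat \<Rightarrow> int vec \<Rightarrow> (nat \<Rightarrow> int)" where
  "deg_map p ds L e = char_class p ds (L *\<^sub>v e)"

definition deg_kernel :: "nat \<Rightarrow> nat list \<Rightarrow> int mat \<Rightarrow> int vec set" where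
  "deg_kernel p ds L = {e \<in> carrier_vec (dim_col L). deg_map p ds L e = \<one>\<^bsub>char_group p ds\<^esub>}"

text \<open>\<open>\<nat>\<^sup>r \<times> \<int>\<^sup>s\<close>\<close>

definition exponents :: "nat \<Rightarrow> nat \<Rightarrow> int vec set" where
  "exponents r s = {e \<in> carrier_vec (r + s). \<forall>i<r. 0 \<le> e $ i}"

definition Q_degrees :: "nat \<Rightarrow> nat list \<Rightarrow> int mat \<Rightarrow> nat \<Rightarrow> nat \<Rightarrow> (nat \<Rightarrow> int) set" where
  "Q_degrees p ds L r s = deg_map p ds L ` exponents r s"

definition is_Z_basis :: "nat \<Rightarrow> int vec list \<Rightarrow> int vec set \<Rightarrow> bool" where
  "is_Z_basis n vs W \<longleftrightarrow>
     set vs \<subseteq> carrier_vec n \<and> distinct vs \<and>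
     \<not> LinearCombinations.module.lin_dep class_ring (module_vec TYPE(int) n) (set vs) \<and>
     LinearCombinations.module.span class_ring (module_vec TYPE(int) n) (set vs) = W"

subsection \<open>Laurent polynomials\<close>

text \<open>Laurent polynomials in variables indexed by \<open>nat\<close>, as the group algebra of the finitely
  supported integer exponents; the ring \<open>k[x\<^sub>1\<^sup>\<plusminus>, \<dots>, x\<^sub>n\<^sup>\<plusminus>]\<close> is the subring in which only the
  variables with index below \<open>n\<close> occur.\<close>

type_synonym 'k laurent = "(nat \<Rightarrow>\<^sub>0 int) \<Rightarrow>\<^sub>0 'k"

definition scale_laurent :: "'k::field \<Rightarrow> 'k laurent \<Rightarrow> 'k laurent" where
  "scale_laurent c f = Poly_Mapping.single 0 c * f"

global_interpretation laurent: vector_space scale_laurent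
  by unfold_locales
    (simp_all add: scale_laurent_def algebra_simps single_add mult_single single_one
      flip: mult.assoc)

text \<open>The monomial \<open>x\<^sup>e\<close>. \<open>Poly_Mapping.nth\<close> turns a list into the finitely supported function on
  \<open>nat\<close> that has the entries of the list as its values and is \<open>0\<close> beyond its length.\<close>

definition monomial :: "int vec \<Rightarrow> 'k::field laurent" where
  "monomial e = Poly_Mapping.single (Poly_Mapping.nth (list_of_vec e)) 1"

text \<open>\<open>k[E]\<close>\<close>

definition monomial_span :: "int vec set \<Rightarrow> 'k::field laurent set" where
  "monomial_span E = laurent.span (monomial ` E)"

definition coord_ring :: "nat \<Rightarrow> nat \<Rightarrow> 'k::field laurent set" where
  "coord_ring r s = monomial_span (exponents r s)"

definition graded_piece ::
    "nat \<Rightarrow> nat list \<Rightarrow> int mat \<Rightarrow> nat \<Rightarrow> nat \<Rightarrow> (nat \<Rightarrow> int) \<Rightarrow> 'k::field laurent set" where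
  "graded_piece p ds L r s a =
     laurent.span {monomial e |e. e \<in> carrier_vec (r + s) \<and>
                         (monomial e :: 'k laurent) \<in> coord_ring r s \<and> deg_map p ds L e = a}"

subsection \<open>The polyhedron\<close>

text \<open>Both \<open>N\<close> and its dual \<open>M\<close> are \<open>\<int>\<^sup>l\<close>, \<open>l = dim_col K\<close>, with the standard pairing; \<open>v\<^sub>i\<close> is the
  \<open>i\<close>-th row of \<open>K\<close>.\<close>

definition polyhedron :: "nat \<Rightarrow> int mat \<Rightarrow> int vec \<Rightarrow> real vec set" where
  "polyhedron r K \<phi> = {u \<in> carrier_vec (dim_col K).
     \<forall>i<r. u \<bullet> map_vec real_of_int (row K i) \<ge> - real_of_int (\<phi> $ i)}"

definition lattice_points :: "nat \<Rightarrow> real vec set \<Rightarrow> int vec set" where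
  "lattice_points l P = {u \<in> carrier_vec l. map_vec real_of_int u \<in> P}"

definition omega :: "int mat \<Rightarrow> int vec \<Rightarrow> int vec" where
  "omega K u = K *\<^sub>v u"

end

theory Submission
  imports Defs
begin

text \<open>
  A monomial lies in \<open>S\<close> exactly when its exponent lies in \<open>\<nat>\<^sup>r \<times> \<int>\<^sup>s\<close>, because monomials are linearly
  independent (\<open>monomial_in_span_iff\<close>). So both sides of the theorem are spans of monomials, and as
  multiplication by \<open>x\<^sup>\<phi>\<close> is linear and shifts exponents by \<open>\<phi>\<close> (\<open>mult_monomial_span\<close>), it is
  enough to compare exponents. There, \<open>deg e = a = deg \<phi>\<close> says that \<open>e - \<phi>\<close> lies in the kernel of the
  degree map, that is, \<open>e = \<phi> + K u\<close> for some \<open>u \<in> \<int>\<^sup>l\<close>; and the inequalities that cut out the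
  polyhedron are the conditions \<open>(\<phi> + K u)\<^sub>i \<ge> 0\<close> for \<open>i < r\<close>
  (\<open>exponents_of_degree_eq_lattice_translate\<close>).
\<close>

section \<open>Monomials and their spans\<close>

lemma nth_list_of_vec_add:
  fixes e e' :: "'a::monoid_add vec"
  assumes "dim_vec e = dim_vec e'"
  shows "Poly_Mapping.nth (list_of_vec (e + e')) =
           Poly_Mapping.nth (list_of_vec e) + Poly_Mapping.nth (list_of_vec e')"
  using assms
  by (intro poly_mapping_eqI) (auto simp: lookup_add nth_default_def list_of_vec_index)

lemma nth_list_of_vec_inj_on: "inj_on (\<lambda>e. Poly_Mapping.nth (list_of_vec e)) (carrier_vec n)"
proof (rule inj_onI)
  fix e e' :: "'a vec"
  assume e: "e \<in> carrier_vec n" "e' \<in> carrier_vec n"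
    and eq: "Poly_Mapping.nth (list_of_vec e) = Poly_Mapping.nth (list_of_vec e')"
  have "e $ i = e' $ i" if "i < n" for i
    using arg_cong[OF eq, of "\<lambda>f. Poly_Mapping.lookup f i"] e that
    by (simp add: nth_default_def list_of_vec_index)
  then show "e = e'"
    using e by (intro eq_vecI) auto
qed

lemma monomial_add:
  assumes "dim_vec e = dim_vec e'"
  shows "(monomial (e + e') :: 'k::field laurent) = monomial e * monomial e'"
  using assms by (simp add: monomial_def nth_list_of_vec_add mult_single)

lemma keys_monomial_span:
  assumes "f \<in> monomial_span E"
  shows "Poly_Mapping.keys f \<subseteq> (\<lambda>e. Poly_Mapping.nth (list_of_vec e)) ` E"
  using assms unfolding monomial_span_def
proof (induction rule: laurent.span_induct_alt)
  case base
  then show ?case by simp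
next
  case (step c g f)
  have "Poly_Mapping.keys (scale_laurent c g) \<subseteq> Poly_Mapping.keys g"
    unfolding scale_laurent_def
    using keys_mult[of "Poly_Mapping.single 0 c" g] by (auto split: if_splits)
  moreover have "Poly_Mapping.keys g \<subseteq> (\<lambda>e. Poly_Mapping.nth (list_of_vec e)) ` E"
    using step.hyps by (auto simp: monomial_def)
  ultimately show ?case
    using step.IH keys_add[of "scale_laurent c g" f] by blast
qed

text \<open>Distinct monomials are linearly independent, so a monomial lies in a span of monomials only
  if it is one of them. Fixing the length of the exponents is essential, since trailing zeros do
  not change a monomial.\<close>

lemma monomial_in_span_iff:
  assumes "E \<subseteq> carrier_vec n" "e \<in> carrier_vec n"
  shows "(monomial e :: 'k::field laurent) \<in> monomial_span E \<longleftrightarrow> e \<in> E"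
proof
  assume "(monomial e :: 'k laurent) \<in> monomial_span E"
  from keys_monomial_span[OF this]
  have "Poly_Mapping.nth (list_of_vec e) \<in> (\<lambda>e. Poly_Mapping.nth (list_of_vec e)) ` E"
    by (simp add: monomial_def)
  then show "e \<in> E"
    using assms nth_list_of_vec_inj_on[of n] by (auto dest: inj_onD)
next
  assume "e \<in> E"
  then show "(monomial e :: 'k laurent) \<in> monomial_span E"
    unfolding monomial_span_def by (intro laurent.span_base) auto
qed

lemma mult_monomial_span:
  assumes "E \<subseteq> carrier_vec n" "\<phi> \<in> carrier_vec n"
  shows "(\<lambda>f. monomial \<phi> * f) ` (monomial_span E :: 'k::field laurent set) =
           monomial_span ((+) \<phi> ` E)"
proof -
  have hom: "Modules.module_hom scale_laurent scale_laurent (\<lambda>f. monomial \<phi> * f :: 'k laurent)"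
    by unfold_locales (simp_all add: scale_laurent_def algebra_simps)
  have "monomial ` (+) \<phi> ` E = (\<lambda>f. monomial \<phi> * f :: 'k laurent) ` monomial ` E"
    unfolding image_image using assms by (intro image_cong refl monomial_add) auto
  then show ?thesis
    unfolding monomial_span_def by (simp add: module_hom.span_image[OF hom])
qed

lemma graded_piece_eq_monomial_span:
  "(graded_piece p ds L r s a :: 'k::field laurent set) =
     monomial_span {e \<in> exponents r s. deg_map p ds L e = a}"
proof -
  have "exponents r s \<subseteq> carrier_vec (r + s)"
    by (auto simp: exponents_def)
  from monomial_in_span_iff[OF this]
  have mem: "(monomial e :: 'k laurent) \<in> monomial_span (exponents r s) \<longleftrightarrow> e \<in> exponents r s"
    if "e \<in> carrier_vec (r + s)" for e
    using that .
  have "{monomial e |e. e \<in> carrier_vec (r + s) \<and>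
        (monomial e :: 'k laurent) \<in> coord_ring r s \<and> deg_map p ds L e = a} =
      (monomial ` {e \<in> exponents r s. deg_map p ds L e = a} :: 'k laurent set)"
    unfolding coord_ring_def using mem by (auto simp: exponents_def)
  then show ?thesis
    unfolding graded_piece_def monomial_span_def by simp
qed

section \<open>Exponents of a given degree\<close>

lemma span_cols_eq_range:
  fixes K :: "'a::idom mat"
  assumes K: "K \<in> carrier_mat n l"
  shows "LinearCombinations.module.span class_ring (module_vec TYPE('a) n) (set (cols K)) =
           (\<lambda>u. K *\<^sub>v u) ` carrier_vec l"
proof -
  interpret idom_vec n "TYPE('a)" .
  have sub: "set (cols K) \<subseteq> carrier_vec n"
    using K cols_dim by blast
  have len: "length (cols K) = l" and mat: "mat_of_cols n (cols K) = K"
    using K by auto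
  have lin: "lincomb_list c (cols K) = K *\<^sub>v Matrix.vec l c" for c
    using lincomb_list_as_mat_mult[of "cols K" c, unfolded len mat] sub
    by (metis carrier_vecD subsetD)
  have "span (set (cols K)) = range (\<lambda>c. K *\<^sub>v Matrix.vec l c)"
    unfolding span_list_as_span[OF sub, symmetric] span_list_def lin by auto
  also have "\<dots> = (\<lambda>u. K *\<^sub>v u) ` range (Matrix.vec l)"
    by (simp add: image_image)
  also have "range (Matrix.vec l :: (nat \<Rightarrow> 'a) \<Rightarrow> 'a vec) = carrier_vec l"
  proof
    show "carrier_vec l \<subseteq> range (Matrix.vec l :: (nat \<Rightarrow> 'a) \<Rightarrow> 'a vec)"
    proof
      fix u :: "'a vec"
      assume "u \<in> carrier_vec l"
      then have "u = Matrix.vec l (($) u)"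
        by (intro eq_vecI) auto
      then show "u \<in> range (Matrix.vec l)"
        by blast
    qed
  qed auto
  finally show ?thesis .
qed

lemma deg_map_eq_iff_diff_in_kernel:
  assumes L: "L \<in> carrier_mat (p + length ds) n"
    and e: "e \<in> carrier_vec n" "e' \<in> carrier_vec n"
  shows "deg_map p ds L e = deg_map p ds L e' \<longleftrightarrow> e - e' \<in> deg_kernel p ds L"
proof -
  have "L *\<^sub>v (e - e') = L *\<^sub>v e - L *\<^sub>v e'"
    using L e by (rule mult_minus_distrib_mat_vec)
  then have diff: "(L *\<^sub>v (e - e')) $ j = (L *\<^sub>v e) $ j - (L *\<^sub>v e') $ j"
    if "j < p + length ds" for j
    using that L by simp
  have "deg_map p ds L e = deg_map p ds L e' \<longleftrightarrow>
      (\<forall>j<p + length ds. (L *\<^sub>v e) $ j mod int (modulus p ds j) =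
                         (L *\<^sub>v e') $ j mod int (modulus p ds j))"
    by (auto simp: deg_map_def char_class_def fun_eq_iff restrict_def)
  also have "\<dots> \<longleftrightarrow> (\<forall>j<p + length ds. (L *\<^sub>v (e - e')) $ j mod int (modulus p ds j) = 0)"
    by (simp add: diff mod_eq_dvd_iff mod_eq_0_iff_dvd)
  also have "\<dots> \<longleftrightarrow> deg_map p ds L (e - e') = \<one>\<^bsub>char_group p ds\<^esub>"
    by (auto simp: deg_map_def char_class_def char_group_def fun_eq_iff restrict_def)
  also have "\<dots> \<longleftrightarrow> e - e' \<in> deg_kernel p ds L"
    using L e by (auto simp: deg_kernel_def)
  finally show ?thesis .
qed

lemma lattice_points_polyhedron_iff:
  assumes K: "K \<in> carrier_mat n l" and "r \<le> n" "\<phi> \<in> carrier_vec n"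
  shows "u \<in> lattice_points l (polyhedron r K \<phi>) \<longleftrightarrow>
           u \<in> carrier_vec l \<and> (\<forall>i<r. 0 \<le> (\<phi> + K *\<^sub>v u) $ i)"
proof -
  have "map_vec real_of_int u \<bullet> map_vec real_of_int (row K i) \<ge> - real_of_int (\<phi> $ i) \<longleftrightarrow>
        0 \<le> (\<phi> + K *\<^sub>v u) $ i"
    if u: "u \<in> carrier_vec l" and i: "i < r" for i
  proof -
    have "map_vec real_of_int u \<bullet> map_vec real_of_int (row K i) = real_of_int (u \<bullet> row K i)"
      using K u by (auto simp: scalar_prod_def intro!: sum.cong)
    also have "u \<bullet> row K i = (K *\<^sub>v u) $ i"
      using K u i \<open>r \<le> n\<close> comm_scalar_prod[OF u row_carrier_vec[OF _ K]] by simp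
    finally show ?thesis
      using assms i by (simp flip: of_int_minus) linarith
  qed
  then show ?thesis
    using K by (auto simp: lattice_points_def polyhedron_def)
qed

text \<open>Exponents of equal degree differ by an element of the kernel, so the fibre of the degree map
  through \<open>\<phi>\<close> is \<open>\<phi> + K \<int>\<^sup>l\<close>; the defining inequalities of the polyhedron at \<open>u\<close> say
  that the first \<open>r\<close> entries of \<open>\<phi> + K u\<close> are nonnegative.\<close>

lemma exponents_of_degree_eq_lattice_translate:
  assumes L: "L \<in> carrier_mat (p + length ds) (r + s)"
    and K: "K \<in> carrier_mat (r + s) l"
    and ker: "deg_kernel p ds L = (\<lambda>u. K *\<^sub>v u) ` carrier_vec l"
    and \<phi>: "\<phi> \<in> carrier_vec (r + s)"
  shows "{e \<in> exponents r s. deg_map p ds L e = deg_map p ds L \<phi>} =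
           (+) \<phi> ` omega K ` lattice_points l (polyhedron r K \<phi>)"
proof (intro Set.set_eqI iffI)
  fix e
  assume e: "e \<in> {e \<in> exponents r s. deg_map p ds L e = deg_map p ds L \<phi>}"
  then have e': "e \<in> carrier_vec (r + s)"
    by (simp add: exponents_def)
  from e have "e - \<phi> \<in> deg_kernel p ds L"
    using deg_map_eq_iff_diff_in_kernel[OF L e' \<phi>] by simp
  then obtain u where u: "u \<in> carrier_vec l" "e - \<phi> = K *\<^sub>v u"
    unfolding ker by blast
  have "\<phi> + (e - \<phi>) = e"
    using e' \<phi> by (intro eq_vecI) auto
  with u have eq: "e = \<phi> + omega K u"
    by (simp add: omega_def)
  with e u have "u \<in> lattice_points l (polyhedron r K \<phi>)"
    by (simp add: lattice_points_polyhedron_iff[OF K _ \<phi>] exponents_def omega_def)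
  with eq show "e \<in> (+) \<phi> ` omega K ` lattice_points l (polyhedron r K \<phi>)"
    by blast
next
  fix e
  assume "e \<in> (+) \<phi> ` omega K ` lattice_points l (polyhedron r K \<phi>)"
  then obtain u where u: "u \<in> lattice_points l (polyhedron r K \<phi>)" and e: "e = \<phi> + K *\<^sub>v u"
    by (auto simp: omega_def)
  then have u': "u \<in> carrier_vec l" and pos: "\<forall>i<r. 0 \<le> e $ i"
    by (simp_all add: lattice_points_polyhedron_iff[OF K _ \<phi>])
  have e': "e \<in> carrier_vec (r + s)"
    using e K \<phi> u' by simp
  have "e - \<phi> = K *\<^sub>v u"
    using e K \<phi> u' by (intro eq_vecI) auto
  then have "e - \<phi> \<in> deg_kernel p ds L"
    using u' ker by blast
  then show "e \<in> {e \<in> exponents r s. deg_map p ds L e = deg_map p ds L \<phi>}"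
    using deg_map_eq_iff_diff_in_kernel[OF L e' \<phi>] e' pos by (simp add: exponents_def)
qed

section \<open>Graded pieces and lattice points of polyhedra\<close>

theorem lemma8p1:
  fixes r s p l :: nat and ds :: "nat list" and L K :: "int mat"
    and a :: "nat \<Rightarrow> int" and \<phi> :: "int vec"
  assumes "\<forall>d\<in>set ds. d > 0"
    and "L \<in> carrier_mat (p + length ds) (r + s)"
    and "faithful_action (diag_group p ds) (affine_torus r s)
           (diag_action p ds L r s ::
             (nat \<Rightarrow> 'k::{alg_closed_field, field_char_0}) \<Rightarrow> 'k vec \<Rightarrow> 'k vec)"
    and "l = r + s - p"
    and "K \<in> carrier_mat (r + s) l"
    and "is_Z_basis (r + s) (cols K) (deg_kernel p ds L)"
    and "a \<in> Q_degrees p ds L r s"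
    and "\<phi> \<in> exponents r s"
    and "deg_map p ds L \<phi> = a"
  shows "(graded_piece p ds L r s a :: 'k laurent set) =
           (\<lambda>f. monomial \<phi> * f) `
             monomial_span (omega K ` lattice_points l (polyhedron r K \<phi>))"
proof -
  note L = assms(2) and K = assms(5)
  have \<phi>: "\<phi> \<in> carrier_vec (r + s)"
    using assms(8) by (simp add: exponents_def)
  have ker: "deg_kernel p ds L = (\<lambda>u. K *\<^sub>v u) ` carrier_vec l"
    using assms(6) span_cols_eq_range[OF K] by (simp add: is_Z_basis_def)
  have sub: "omega K ` lattice_points l (polyhedron r K \<phi>) \<subseteq> carrier_vec (r + s)"
    using K by (auto simp: omega_def lattice_points_def)
  show ?thesis
    unfolding graded_piece_eq_monomial_span mult_monomial_span[OF sub \<phi>]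
      exponents_of_degree_eq_lattice_translate[OF L K ker \<phi>, unfolded assms(9)] ..
qed

end
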